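(* Let $\mu\in\mathbb{R}$, $\sigma>0$, $\delta=\mu/\sigma$, and let $1\le r<s<t\le n$. Let $X_{1:n}<\dots<X_{n:n}$ be the order statistics of a sample of size $n$ from the density $\frac1\sigma f\left(\frac{x-\mu}{\sigma}\right)$, and let $\boldsymbol X=(X_{1:n},\dots,X_{r:n})^\top$. For $q\in\{s,t\}$ let $\hat X_{q:n}$ be the marginal best linear invariant predictor of $X_{q:n}$, i.e. the minimizer of $E[(\boldsymbol c^\top\boldsymbol X-X_{q:n})^2]$ over predictors $\boldsymbol c^\top \boldsymbol X$, $\boldsymbol c\in\mathbb{R}^r$. Then $\hat X_{s:n}=(\boldsymbol\Gamma^{-1}\boldsymbol\Delta_s)^\top\boldsymbol X$ and $\hat X_{t:n}=(\boldsymbol\Gamma^{-1}\boldsymbol\Delta_t)^\top\boldsymbol X$, where $$\boldsymbol\Gamma=\boldsymbol\Sigma+(\boldsymbol\alpha+\delta\boldsymbol 1)(\boldsymbol\alpha+\delta\boldsymbol 1)^\top,\qquad \boldsymbol\Delta_q=\boldsymbol\omega_q+(\alpha_q+\delta)(\boldsymbol\alpha+\delta\boldsymbol 1)\quad (q\in\{s,t\}).$$ Moreover, the pair $(\hat X_{s:n},\hat X_{t:n})$ is trace-efficient: among all pairs $(\boldsymbol a^\top\boldsymbol X,\boldsymbol b^\top\boldsymbol X)$ with $\boldsymbol a,\boldsymbol b\in\mathbb{R}^r$, it minimizes the trace of the mean squared predictive error matrix $E[\boldsymbol e\boldsymbol e^\top]$, where $\boldsymbol e=(\boldsymbol a^\top\boldsymbol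 X-X_{s:n},\ \boldsymbol b^\top\boldsymbol X-X_{t:n})^\top$.
   Context: $f$ is a probability density on $\mathbb{R}$, and the sample consists of $n$ i.i.d. random variables with density $\frac1\sigma f\left(\frac{x-\mu}{\sigma}\right)$ (location-scale family). The standardized order statistics are $Z_{i:n}=(X_{i:n}-\mu)/\sigma$, $1\le i\le n$, assumed to have finite second moments. Notation: $\alpha_i=E[Z_{i:n}]$ for $1\le i\le n$; $\boldsymbol\alpha=(\alpha_1,\dots,\alpha_r)^\top$; $\boldsymbol 1=(1,\dots,1)^\top\in\mathbb{R}^r$; $\boldsymbol\Sigma$ is the $r\times r$ covariance matrix of $(Z_{1:n},\dots,Z_{r:n})^\top$, assumed positive definite; $\boldsymbol\omega_q=(\mathrm{Cov}(Z_{1:n},Z_{q:n}),\dots,\mathrm{Cov}(Z_{r:n},Z_{q:n}))^\top\in\mathbb{R}^r$. Minimizations are for fixed $\mu,\sigma$, over all coefficient vectors in $\mathbb{R}^r$, with no unbiasedness constraint. *)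

theory Defs
  imports "HOL-Probability.Probability" "Jordan_Normal_Form.Gauss_Jordan_Elimination"
begin

no_notation inner (infix \<open>\<bullet>\<close> 70)
no_notation vec_nth (infixl \<open>$\<close> 90)

text \<open>\<open>order_stat n X i\<close> is \<open>X\<^bsub>i:n\<^esub>\<close>, the \<open>i\<close>-th smallest of \<open>X\<^sub>1, \<dots>, X\<^sub>n\<close>.
  Sample and order statistics are indexed from 1, lists and vectors from 0.\<close>

definition order_stat :: "nat \<Rightarrow> (nat \<Rightarrow> 'w \<Rightarrow> real) \<Rightarrow> nat \<Rightarrow> 'w \<Rightarrow> real" where
  "order_stat n X i \<omega> = sort (map (\<lambda>j. X j \<omega>) [1..<Suc n]) ! (i - 1)"

definition std_order_stat ::
  "real \<Rightarrow> real \<Rightarrow> nat \<Rightarrow> (nat \<Rightarrow> 'w \<Rightarrow> real) \<Rightarrow> nat \<Rightarrow> 'w \<Rightarrow> real" where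
  "std_order_stat \<mu> \<sigma> n X i \<omega> = (order_stat n X i \<omega> - \<mu>) / \<sigma>"

definition covar :: "'w measure \<Rightarrow> ('w \<Rightarrow> real) \<Rightarrow> ('w \<Rightarrow> real) \<Rightarrow> real" where
  "covar M U V = (LINT \<omega>|M. (U \<omega> - (LINT \<omega>|M. U \<omega>)) * (V \<omega> - (LINT \<omega>|M. V \<omega>)))"

definition first_vec :: "nat \<Rightarrow> (nat \<Rightarrow> 'a) \<Rightarrow> 'a vec" where
  "first_vec r u = vec r (\<lambda>i. u (Suc i))"

definition cov_mat :: "'w measure \<Rightarrow> nat \<Rightarrow> (nat \<Rightarrow> 'w \<Rightarrow> real) \<Rightarrow> real mat" where
  "cov_mat M r Z = mat r r (\<lambda>(i, j). covar M (Z (Suc i)) (Z (Suc j)))"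

definition mean :: "'w measure \<Rightarrow> (nat \<Rightarrow> 'w \<Rightarrow> real) \<Rightarrow> nat \<Rightarrow> real" where
  "mean M Z i = (LINT \<omega>|M. Z i \<omega>)"

definition outer_prod :: "real vec \<Rightarrow> real vec \<Rightarrow> real mat" where
  "outer_prod u v = mat (dim_vec u) (dim_vec v) (\<lambda>(i, j). u $ i * v $ j)"

definition pos_def_mat :: "real mat \<Rightarrow> bool" where
  "pos_def_mat A \<longleftrightarrow> square_mat A \<and> transpose_mat A = A \<and>
     (\<forall>v \<in> carrier_vec (dim_row A). v \<noteq> 0\<^sub>v (dim_row A) \<longrightarrow> v \<bullet> (A *\<^sub>v v) > 0)"

definition trace_mat :: "real mat \<Rightarrow> real" where
  "trace_mat A = (\<Sum>i<dim_row A. A $$ (i, i))"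

definition shifted_mean_vec :: "'w measure \<Rightarrow> nat \<Rightarrow> (nat \<Rightarrow> 'w \<Rightarrow> real) \<Rightarrow> real \<Rightarrow> real vec" where
  "shifted_mean_vec M r Z \<delta> = first_vec r (mean M Z) + \<delta> \<cdot>\<^sub>v first_vec r (\<lambda>_. 1)"

definition Gamma_mat :: "'w measure \<Rightarrow> nat \<Rightarrow> (nat \<Rightarrow> 'w \<Rightarrow> real) \<Rightarrow> real \<Rightarrow> real mat" where
  "Gamma_mat M r Z \<delta> =
     cov_mat M r Z + outer_prod (shifted_mean_vec M r Z \<delta>) (shifted_mean_vec M r Z \<delta>)"

definition Delta_vec ::
  "'w measure \<Rightarrow> nat \<Rightarrow> (nat \<Rightarrow> 'w \<Rightarrow> real) \<Rightarrow> real \<Rightarrow> nat \<Rightarrow> real vec" where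
  "Delta_vec M r Z \<delta> q =
     first_vec r (\<lambda>i. covar M (Z i) (Z q)) + (mean M Z q + \<delta>) \<cdot>\<^sub>v shifted_mean_vec M r Z \<delta>"

text \<open>In the following definitions \<open>Y i\<close> is the \<open>i\<close>-th order statistic; the first \<open>r\<close> are observed.\<close>

definition lin_pred :: "nat \<Rightarrow> (nat \<Rightarrow> 'w \<Rightarrow> real) \<Rightarrow> real vec \<Rightarrow> 'w \<Rightarrow> real" where
  "lin_pred r Y c \<omega> = c \<bullet> first_vec r (\<lambda>i. Y i \<omega>)"

definition lin_preds :: "nat \<Rightarrow> (nat \<Rightarrow> 'w \<Rightarrow> real) \<Rightarrow> ('w \<Rightarrow> real) set" where
  "lin_preds r Y = lin_pred r Y ` carrier_vec r"

definition marginal_BLIP ::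
  "'w measure \<Rightarrow> nat \<Rightarrow> (nat \<Rightarrow> 'w \<Rightarrow> real) \<Rightarrow> nat \<Rightarrow> ('w \<Rightarrow> real) \<Rightarrow> bool" where
  "marginal_BLIP M r Y q =
     is_arg_min (\<lambda>P. LINT \<omega>|M. (P \<omega> - Y q \<omega>)\<^sup>2) (\<lambda>P. P \<in> lin_preds r Y)"

definition mspe_mat :: "'w measure \<Rightarrow> ('w \<Rightarrow> real vec) \<Rightarrow> real mat" where
  "mspe_mat M e = mat 2 2 (\<lambda>(i, j). LINT \<omega>|M. outer_prod (e \<omega>) (e \<omega>) $$ (i, j))"

definition trace_efficient ::
  "'w measure \<Rightarrow> nat \<Rightarrow> (nat \<Rightarrow> 'w \<Rightarrow> real) \<Rightarrow> nat \<Rightarrow> nat \<Rightarrow> ('w \<Rightarrow> real) \<times> ('w \<Rightarrow> real) \<Rightarrow> bool" where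
  "trace_efficient M r Y s t =
     is_arg_min
       (\<lambda>(P, Q). trace_mat (mspe_mat M (\<lambda>\<omega>. vec_of_list [P \<omega> - Y s \<omega>, Q \<omega> - Y t \<omega>])))
       (\<lambda>pq. pq \<in> lin_preds r Y \<times> lin_preds r Y)"

end

theory Submission
  imports Defs "Jordan_Normal_Form.Determinant"
begin

text \<open>
  Writing \<open>Y\<^sub>i = \<sigma> (Z\<^sub>i + \<delta>)\<close>, the matrix \<open>\<sigma>\<^sup>2 \<Gamma>\<close> consists of the second moments
  \<open>E[Y\<^sub>i Y\<^sub>j]\<close> and the vector \<open>\<sigma>\<^sup>2 \<Delta>\<^sub>q\<close> of the mixed moments \<open>E[Y\<^sub>i Y\<^sub>q]\<close>. Hence the risk of
  the predictor with coefficients \<open>c\<close> is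
  \<open>E[Y\<^sub>q\<^sup>2] + \<sigma>\<^sup>2 (c \<bullet> \<Gamma> c - 2 c \<bullet> \<Delta>\<^sub>q)\<close>, and completing the square shows that it exceeds the risk
  at \<open>c\<^sub>0 = \<Gamma>\<^sup>-\<^sup>1 \<Delta>\<^sub>q\<close> by \<open>\<sigma>\<^sup>2 (c - c\<^sub>0) \<bullet> \<Gamma> (c - c\<^sub>0)\<close>. The matrix \<open>\<Gamma>\<close> inherits positive
  definiteness from \<open>\<Sigma>\<close>. The trace of the error matrix is the sum of the two marginal risks, so it
  is minimized coordinatewise.
\<close>

section \<open>Measurability of order statistics\<close>

text \<open>In a sorted list the entries that are at most \<open>a\<close> form a prefix, whose
  length is the number kept by the filter.\<close>

lemma sorted_nth_le_iff:
  fixes xs :: "'a::linorder list"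
  assumes "sorted xs" "i < length xs"
  shows "xs ! i \<le> a \<longleftrightarrow> i < length (filter (\<lambda>x. x \<le> a) xs)"
  using assms
proof (induction xs arbitrary: i)
  case (Cons x xs)
  have none: "filter (\<lambda>x. x \<le> a) xs = []" if "\<not> x \<le> a"
    using that Cons.prems(1) by (auto simp: filter_empty_conv)
  show ?case
  proof (cases i)
    case 0
    then show ?thesis using none by auto
  next
    case (Suc k)
    have "x \<le> xs ! k"
      using Cons.prems Suc by auto
    then show ?thesis
      using Cons Suc none by (cases "x \<le> a") auto
  qed
qed simp

text \<open>Sorting is traded for counting: the \<open>i\<close>-th smallest value is at most
  \<open>a\<close> iff at least \<open>i\<close> sample values are, and this count is a finite sum
  of indicators of measurable events.\<close>

lemma borel_measurable_order_stat:
  assumes X: "\<And>j. j \<in> {1..n} \<Longrightarrow> X j \<in> borel_measurable M"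
    and i: "i \<in> {1..n}"
  shows "order_stat n X i \<in> borel_measurable M"
proof (rule borel_measurable_iff_le[THEN iffD2], intro allI)
  fix a :: real
  let ?c = "\<lambda>\<omega>. real (length (filter (\<lambda>j. X j \<omega> \<le> a) [1..<Suc n]))"
  have count: "(\<lambda>\<omega>. real (length (filter (\<lambda>j. X j \<omega> \<le> a) js))) \<in> borel_measurable M"
    if "set js \<subseteq> {1..n}" for js
    using that
  proof (induction js)
    case (Cons j js)
    then have [measurable]: "X j \<in> borel_measurable M"
      "(\<lambda>\<omega>. real (length (filter (\<lambda>j. X j \<omega> \<le> a) js))) \<in> borel_measurable M"
      by (auto intro: X)
    have "(\<lambda>\<omega>. real (length (filter (\<lambda>j. X j \<omega> \<le> a) (j # js)))) =
        (\<lambda>\<omega>. (if X j \<omega> \<le> a then 1 else 0) + real (length (filter (\<lambda>j. X j \<omega> \<le> a) js)))"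
      by auto
    also have "\<dots> \<in> borel_measurable M"
      by measurable
    finally show ?case .
  qed simp
  \<comment> \<open>Lists start at 0, so \<open>i - 1 < ?c \<omega>\<close> says that the count is
    at least \<open>i\<close>. Filtering commutes with sorting, and sorting preserves the
    length.\<close>
  have "order_stat n X i \<omega> \<le> a \<longleftrightarrow> real (i - 1) < ?c \<omega>" for \<omega>
    using i unfolding order_stat_def
    by (subst sorted_nth_le_iff) (auto simp: filter_sort filter_map o_def simp del: upt_Suc)
  moreover have "?c \<in> borel_measurable M"
    by (rule count) auto
  then have "{\<omega> \<in> space M. real (i - 1) < ?c \<omega>} \<in> sets M"
    by (intro borel_measurable_less borel_measurable_const)
  ultimately show "{\<omega> \<in> space M. order_stat n X i \<omega> \<le> a} \<in> sets M"
    by (simp only:)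
qed

section \<open>Second moments\<close>

text \<open>The sum of the squares dominates the product, because 2|xy| \<le> x^2 + y^2.\<close>

lemma integrable_mult_of_squares:
  fixes U V :: "'w \<Rightarrow> real"
  assumes "U \<in> borel_measurable M" "V \<in> borel_measurable M"
    and "integrable M (\<lambda>\<omega>. (U \<omega>)\<^sup>2)" "integrable M (\<lambda>\<omega>. (V \<omega>)\<^sup>2)"
  shows "integrable M (\<lambda>\<omega>. U \<omega> * V \<omega>)"
proof (rule Bochner_Integration.integrable_bound)
  show "integrable M (\<lambda>\<omega>. (U \<omega>)\<^sup>2 + (V \<omega>)\<^sup>2)"
    using assms by simp
  have "\<bar>x * y\<bar> \<le> x\<^sup>2 + y\<^sup>2" for x y :: real
    using sum_squares_bound[of "\<bar>x\<bar>" "\<bar>y\<bar>"] mult_nonneg_nonneg[of "\<bar>x\<bar>" "\<bar>y\<bar>"]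
    by (simp add: abs_mult del: mult_nonneg_nonneg)
  then show "AE \<omega> in M. norm (U \<omega> * V \<omega>) \<le> norm ((U \<omega>)\<^sup>2 + (V \<omega>)\<^sup>2)"
    by simp
qed (use assms in measurable)

text \<open>With \<open>k\<close> = \<sigma> and \<open>d\<close> = \<delta> this expresses the
  product moments of the order statistics by the entries of \<Gamma> and \<Delta>, up to the factor
  \<sigma>^2.\<close>

lemma (in prob_space) integral_mult_affine:
  fixes U V :: "'a \<Rightarrow> real"
  assumes [simp]: "integrable M U" "integrable M V" "integrable M (\<lambda>\<omega>. U \<omega> * V \<omega>)"
  shows "(LINT \<omega>|M. (k * (U \<omega> + d)) * (k * (V \<omega> + d))) =
    k\<^sup>2 * (covar M U V + (expectation U + d) * (expectation V + d))"
proof -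
  have "(LINT \<omega>|M. (k * (U \<omega> + d)) * (k * (V \<omega> + d))) =
      (LINT \<omega>|M. k\<^sup>2 * (U \<omega> * V \<omega> + d * U \<omega> + d * V \<omega> + d\<^sup>2))"
    by (simp add: algebra_simps power2_eq_square)
  also have "\<dots> = k\<^sup>2 * (expectation (\<lambda>\<omega>. U \<omega> * V \<omega>) + d * expectation U + d * expectation V + d\<^sup>2)"
    by (simp add: prob_space)
  finally have 1: "(LINT \<omega>|M. (k * (U \<omega> + d)) * (k * (V \<omega> + d))) = \<dots>" .
  have "covar M U V = (LINT \<omega>|M. U \<omega> * V \<omega> - expectation V * U \<omega> - expectation U * V \<omega>
      + expectation U * expectation V)"
    unfolding covar_def by (simp add: algebra_simps)
  also have "\<dots> = expectation (\<lambda>\<omega>. U \<omega> * V \<omega>) - expectation U * expectation V"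
    by (simp add: prob_space)
  finally have "expectation (\<lambda>\<omega>. U \<omega> * V \<omega>) = covar M U V + expectation U * expectation V"
    by simp
  then show ?thesis
    unfolding 1 by (simp add: algebra_simps power2_eq_square)
qed

section \<open>Positive definite matrices and quadratic forms\<close>

lemma scalar_prod_outer_prod:
  assumes "u \<in> carrier_vec n" "v \<in> carrier_vec n"
  shows "v \<bullet> (outer_prod u u *\<^sub>v v) = (v \<bullet> u)\<^sup>2"
proof -
  have "v \<bullet> (outer_prod u u *\<^sub>v v) = (\<Sum>i<n. v $ i * (\<Sum>j<n. u $ i * u $ j * v $ j))"
    using assms
    by (auto simp: scalar_prod_def outer_prod_def atLeast0LessThan intro!: sum.cong)
  also have "\<dots> = (\<Sum>i<n. \<Sum>j<n. (v $ i * u $ i) * (v $ j * u $ j))"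
    by (simp add: sum_distrib_left mult_ac)
  also have "\<dots> = (v \<bullet> u)\<^sup>2"
    using assms
    by (simp add: scalar_prod_def power2_eq_square sum_product atLeast0LessThan)
  finally show ?thesis .
qed

text \<open>The rank-one summand adds the square of \<open>v \<bullet> u\<close> to the quadratic
  form, which therefore stays positive.\<close>

lemma pos_def_mat_add_outer_prod:
  assumes A: "pos_def_mat A" "A \<in> carrier_mat n n" and u: "u \<in> carrier_vec n"
  shows "pos_def_mat (A + outer_prod u u)"
proof -
  have O: "outer_prod u u \<in> carrier_mat n n"
    using u by (simp add: outer_prod_def)
  have "transpose_mat (outer_prod u u) = outer_prod u u"
    by (rule eq_matI) (auto simp: outer_prod_def)
  then have "transpose_mat (A + outer_prod u u) = A + outer_prod u u"
    using A O by (simp add: transpose_add pos_def_mat_def)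
  moreover have "v \<bullet> ((A + outer_prod u u) *\<^sub>v v) > 0"
    if v: "v \<in> carrier_vec n" "v \<noteq> 0\<^sub>v n" for v
  proof -
    have "v \<bullet> ((A + outer_prod u u) *\<^sub>v v) = v \<bullet> (A *\<^sub>v v) + (v \<bullet> u)\<^sup>2"
      using A O u v
      by (simp add: add_mult_distrib_mat_vec[where nr = n and nc = n]
          scalar_prod_add_distrib[where n = n] scalar_prod_outer_prod[where n = n])
    moreover have "v \<bullet> (A *\<^sub>v v) > 0"
      using A v by (auto simp: pos_def_mat_def)
    ultimately show ?thesis
      by (simp add: add_pos_nonneg)
  qed
  ultimately show ?thesis
    using A O unfolding pos_def_mat_def by auto
qed

text \<open>A kernel vector has quadratic form 0 and so vanishes. Hence the determinant is nonzero,
  and \<open>mat_inverse\<close> cannot return \<open>None\<close>.\<close>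

lemma pos_def_mat_inverse:
  assumes A: "pos_def_mat A" "A \<in> carrier_mat n n"
  obtains B where "mat_inverse A = Some B" "A * B = 1\<^sub>m n" "B * A = 1\<^sub>m n" "B \<in> carrier_mat n n"
proof -
  have "A *\<^sub>v v \<noteq> 0\<^sub>v n" if "v \<in> carrier_vec n" "v \<noteq> 0\<^sub>v n" for v
    using A that by (auto simp: pos_def_mat_def)
  then have "det A \<noteq> 0"
    using A by (auto simp: det_0_iff_vec_prod_zero_field)
  then have "A \<in> Units (ring_mat TYPE(real) n ())"
    using A by (intro det_non_zero_imp_unit)
  then obtain B where "mat_inverse A = Some B"
    using mat_inverse(1)[OF A(2), of "()"] by (cases "mat_inverse A") auto
  then show ?thesis
    using that mat_inverse(2)[OF A(2)] by blast
qed

text \<open>Writing the linear coefficient as \<open>A *\<^sub>v c\<^sub>0\<close> makes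
  \<open>c\<^sub>0\<close> the vertex and keeps inverses out of the identity.\<close>

lemma quadratic_form_complete_square:
  fixes A :: "real mat"
  assumes A: "A \<in> carrier_mat n n" "transpose_mat A = A"
    and c: "c \<in> carrier_vec n" "c\<^sub>0 \<in> carrier_vec n"
  shows "c \<bullet> (A *\<^sub>v c) - 2 * (c \<bullet> (A *\<^sub>v c\<^sub>0)) =
    (c - c\<^sub>0) \<bullet> (A *\<^sub>v (c - c\<^sub>0)) - c\<^sub>0 \<bullet> (A *\<^sub>v c\<^sub>0)"
proof -
  \<comment> \<open>Symmetry of \<open>A\<close> merges the two cross terms of the square.\<close>
  have "c\<^sub>0 \<bullet> (A *\<^sub>v c) = c \<bullet> (A *\<^sub>v c\<^sub>0)"
    using transpose_vec_mult_scalar[of A n n c c\<^sub>0] comm_scalar_prod[of "A *\<^sub>v c\<^sub>0" n c] A c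
    by simp
  then show ?thesis
    using A c
    by (simp add: mult_minus_distrib_mat_vec[where nr = n and nc = n]
        scalar_prod_minus_distrib[where n = n] minus_scalar_prod_distrib[where n = n])
qed

section \<open>Mean squared error of linear predictors\<close>

lemma lin_pred_eq_sum:
  "lin_pred r Y c \<omega> = (\<Sum>i<r. c $ i * Y (Suc i) \<omega>)"
  by (simp add: lin_pred_def first_vec_def scalar_prod_def atLeast0LessThan)

lemma risk_lin_pred:
  fixes Y :: "nat \<Rightarrow> 'w \<Rightarrow> real"
  assumes int: "\<And>i j. i \<in> {1..r} \<union> {q} \<Longrightarrow> j \<in> {1..r} \<union> {q} \<Longrightarrow> integrable M (\<lambda>\<omega>. Y i \<omega> * Y j \<omega>)"
    and A: "A \<in> carrier_mat r r"
    and d: "d \<in> carrier_vec r"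
    and A_entry: "\<And>i j. i < r \<Longrightarrow> j < r \<Longrightarrow> (LINT \<omega>|M. Y (Suc i) \<omega> * Y (Suc j) \<omega>) = k * A $$ (i, j)"
    and d_entry: "\<And>i. i < r \<Longrightarrow> (LINT \<omega>|M. Y (Suc i) \<omega> * Y q \<omega>) = k * d $ i"
    and c: "c \<in> carrier_vec r"
  shows "(LINT \<omega>|M. (lin_pred r Y c \<omega> - Y q \<omega>)\<^sup>2) =
    k * (c \<bullet> (A *\<^sub>v c) - 2 * (c \<bullet> d)) + (LINT \<omega>|M. (Y q \<omega>)\<^sup>2)"
proof -
  \<comment> \<open>\<open>has_bochner_integral\<close> carries integrability and value together, so
    the expanded square can be integrated termwise in one pass.\<close>
  have hbi: "has_bochner_integral M (\<lambda>\<omega>. Y (Suc i) \<omega> * Y (Suc j) \<omega>) (k * A $$ (i, j))"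
    if "i < r" "j < r" for i j
    using that by (auto simp: has_bochner_integral_iff A_entry intro!: int)
  have hbi_q: "has_bochner_integral M (\<lambda>\<omega>. Y (Suc i) \<omega> * Y q \<omega>) (k * d $ i)" if "i < r" for i
    using that by (auto simp: has_bochner_integral_iff d_entry intro!: int)
  have hbi_qq: "has_bochner_integral M (\<lambda>\<omega>. (Y q \<omega>)\<^sup>2) (LINT \<omega>|M. (Y q \<omega>)\<^sup>2)"
    using int[of q q] by (simp add: has_bochner_integral_iff power2_eq_square)
  have "(lin_pred r Y c \<omega> - Y q \<omega>)\<^sup>2 =
      (\<Sum>i<r. \<Sum>j<r. (c $ i * c $ j) * (Y (Suc i) \<omega> * Y (Suc j) \<omega>))
      - 2 * (\<Sum>i<r. c $ i * (Y (Suc i) \<omega> * Y q \<omega>)) + (Y q \<omega>)\<^sup>2" for \<omega>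
    unfolding lin_pred_eq_sum power2_diff power2_eq_square[of "sum _ _"] sum_product
    by (simp add: sum_distrib_left sum_distrib_right mult_ac)
  moreover have "has_bochner_integral M
      (\<lambda>\<omega>. (\<Sum>i<r. \<Sum>j<r. (c $ i * c $ j) * (Y (Suc i) \<omega> * Y (Suc j) \<omega>))
        - 2 * (\<Sum>i<r. c $ i * (Y (Suc i) \<omega> * Y q \<omega>)) + (Y q \<omega>)\<^sup>2)
      ((\<Sum>i<r. \<Sum>j<r. (c $ i * c $ j) * (k * A $$ (i, j)))
        - 2 * (\<Sum>i<r. c $ i * (k * d $ i)) + (LINT \<omega>|M. (Y q \<omega>)\<^sup>2))"
    by (intro has_bochner_integral_add has_bochner_integral_diff has_bochner_integral_sum
        has_bochner_integral_mult_right hbi hbi_q hbi_qq) auto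
  ultimately have "(LINT \<omega>|M. (lin_pred r Y c \<omega> - Y q \<omega>)\<^sup>2) =
      (\<Sum>i<r. \<Sum>j<r. (c $ i * c $ j) * (k * A $$ (i, j)))
      - 2 * (\<Sum>i<r. c $ i * (k * d $ i)) + (LINT \<omega>|M. (Y q \<omega>)\<^sup>2)"
    by (simp add: has_bochner_integral_integral_eq)
  moreover have "c \<bullet> (A *\<^sub>v c) = (\<Sum>i<r. \<Sum>j<r. (c $ i * c $ j) * A $$ (i, j))"
    using A c
    by (auto simp: scalar_prod_def atLeast0LessThan sum_distrib_left mult_ac intro!: sum.cong)
  moreover have "c \<bullet> d = (\<Sum>i<r. c $ i * d $ i)"
    using d by (simp add: scalar_prod_def atLeast0LessThan)
  ultimately show ?thesis
    by (simp add: sum_distrib_left right_diff_distrib mult_ac)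
qed

text \<open>By \<open>d_entry\<close>, \<open>c\<^sub>0\<close> solves the normal equations.
  Positive definiteness makes the excess risk strict, so the optimal coefficients are
  unique.\<close>

lemma marginal_BLIP_iff:
  fixes Y :: "nat \<Rightarrow> 'w \<Rightarrow> real"
  assumes int: "\<And>i j. i \<in> {1..r} \<union> {q} \<Longrightarrow> j \<in> {1..r} \<union> {q} \<Longrightarrow> integrable M (\<lambda>\<omega>. Y i \<omega> * Y j \<omega>)"
    and A: "A \<in> carrier_mat r r" "pos_def_mat A" and k: "k > 0"
    and A_entry: "\<And>i j. i < r \<Longrightarrow> j < r \<Longrightarrow> (LINT \<omega>|M. Y (Suc i) \<omega> * Y (Suc j) \<omega>) = k * A $$ (i, j)"
    and d_entry: "\<And>i. i < r \<Longrightarrow> (LINT \<omega>|M. Y (Suc i) \<omega> * Y q \<omega>) = k * (A *\<^sub>v c\<^sub>0) $ i"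
    and c\<^sub>0: "c\<^sub>0 \<in> carrier_vec r"
  shows "marginal_BLIP M r Y q P \<longleftrightarrow> P = lin_pred r Y c\<^sub>0"
proof -
  define risk where "risk P = (LINT \<omega>|M. (P \<omega> - Y q \<omega>)\<^sup>2)" for P
  have risk: "risk (lin_pred r Y c) = k * ((c - c\<^sub>0) \<bullet> (A *\<^sub>v (c - c\<^sub>0))) + risk (lin_pred r Y c\<^sub>0)"
    if "c \<in> carrier_vec r" for c
  proof -
    \<comment> \<open>Kept general in \<open>c\<close>: subtracting the instance at
      \<open>c\<^sub>0\<close> cancels the second moment of \<open>Y q\<close> and the constant of
      the completed square.\<close>
    have sq: "risk (lin_pred r Y c) = k * ((c - c\<^sub>0) \<bullet> (A *\<^sub>v (c - c\<^sub>0)) - c\<^sub>0 \<bullet> (A *\<^sub>v c\<^sub>0))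
        + (LINT \<omega>|M. (Y q \<omega>)\<^sup>2)" if "c \<in> carrier_vec r" for c
      unfolding risk_def using risk_lin_pred[OF int A(1) _ A_entry d_entry that] A c\<^sub>0 that
      by (simp add: quadratic_form_complete_square pos_def_mat_def)
    show ?thesis
      using sq[OF that] sq[OF c\<^sub>0] A c\<^sub>0 by (simp add: right_diff_distrib)
  qed
  have less: "risk (lin_pred r Y c\<^sub>0) < risk (lin_pred r Y c)"
    if c: "c \<in> carrier_vec r" "c \<noteq> c\<^sub>0" for c
  proof -
    have "c - c\<^sub>0 \<noteq> 0\<^sub>v r"
      using c c\<^sub>0 by (auto simp: vec_eq_iff)
    then have "(c - c\<^sub>0) \<bullet> (A *\<^sub>v (c - c\<^sub>0)) > 0"
      using A c c\<^sub>0 by (auto simp: pos_def_mat_def)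
    then show ?thesis
      using risk[OF c(1)] k by simp
  qed
  have "marginal_BLIP M r Y q P \<longleftrightarrow>
      P \<in> lin_pred r Y ` carrier_vec r \<and> (\<forall>c\<in>carrier_vec r. \<not> risk (lin_pred r Y c) < risk P)"
    by (auto simp: marginal_BLIP_def lin_preds_def is_arg_min_def risk_def)
  then show ?thesis
    using less c\<^sub>0 by (auto dest: less_asym)
qed

text \<open>The diagonal of the error matrix holds the two marginal risks, and the pairs range over
  a product set, so each summand is minimized separately.\<close>

lemma trace_efficient_of_marginal_BLIPs:
  assumes "marginal_BLIP M r Y s P" "marginal_BLIP M r Y t Q"
  shows "trace_efficient M r Y s t (P, Q)"
proof -
  let ?risk = "\<lambda>q P. LINT \<omega>|M. (P \<omega> - Y q \<omega>)\<^sup>2"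
  have trace: "trace_mat (mspe_mat M (\<lambda>\<omega>. vec_of_list [P \<omega> - Y s \<omega>, Q \<omega> - Y t \<omega>])) =
      ?risk s P + ?risk t Q" for P Q
    by (simp add: trace_mat_def mspe_mat_def outer_prod_def numeral_2_eq_2 power2_eq_square)
  have "P \<in> lin_preds r Y" "Q \<in> lin_preds r Y"
    using assms by (auto simp: marginal_BLIP_def is_arg_min_def)
  moreover have "?risk s P + ?risk t Q \<le> ?risk s P' + ?risk t Q'"
    if "P' \<in> lin_preds r Y" "Q' \<in> lin_preds r Y" for P' Q'
    using assms that by (intro add_mono) (auto simp: marginal_BLIP_def is_arg_min_def not_less)
  ultimately show ?thesis
    unfolding trace_efficient_def is_arg_min_def
    by (auto simp only: trace mem_Times_iff split_paired_all prod.case fst_conv snd_conv not_less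
        simp flip: not_le)
qed

section \<open>Optimal prediction in the location-scale model\<close>

text \<open>The equivalences give existence and uniqueness of the marginal predictors, so the final
  implication is not vacuous. Invertibility ensures that \<open>the\<close> is applied to a genuine
  inverse.\<close>

theorem corollary1:
  fixes M :: "'w measure"
    and X :: "nat \<Rightarrow> 'w \<Rightarrow> real"
    and f :: "real \<Rightarrow> real"
    and \<mu> \<sigma> \<delta> :: real
    and n r s t :: nat
    and Y Z :: "nat \<Rightarrow> 'w \<Rightarrow> real"
    and \<Gamma> :: "real mat"
    and \<Delta> :: "nat \<Rightarrow> real vec"
  assumes f_measurable: "f \<in> borel_measurable borel"
    and f_nonneg: "\<And>x. 0 \<le> f x"
    and f_integral: "has_bochner_integral lborel f 1"
    and M: "prob_space M"
    and sigma_pos: "\<sigma> > 0"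
    and delta: "\<delta> = \<mu> / \<sigma>"
    and indep: "prob_space.indep_vars M (\<lambda>_. borel) X {1..n}"
    and density: "\<And>i. i \<in> {1..n} \<Longrightarrow>
      distributed M lborel (X i) (\<lambda>x. ennreal (1 / \<sigma> * f ((x - \<mu>) / \<sigma>)))"
    and indices: "1 \<le> r" "r < s" "s < t" "t \<le> n"
    and Y: "Y = order_stat n X"
    and Z: "Z = std_order_stat \<mu> \<sigma> n X"
    and second_moments: "\<And>i. i \<in> {1..n} \<Longrightarrow> integrable M (\<lambda>\<omega>. (Z i \<omega>)\<^sup>2)"
    and Sigma_pos_def: "pos_def_mat (cov_mat M r Z)"
    and Gamma: "\<Gamma> = Gamma_mat M r Z \<delta>"
    and Delta: "\<Delta> = Delta_vec M r Z \<delta>"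
  shows "invertible_mat \<Gamma> \<and>
    (\<forall>P. marginal_BLIP M r Y s P \<longleftrightarrow> P = lin_pred r Y (the (mat_inverse \<Gamma>) *\<^sub>v \<Delta> s)) \<and>
    (\<forall>Q. marginal_BLIP M r Y t Q \<longleftrightarrow> Q = lin_pred r Y (the (mat_inverse \<Gamma>) *\<^sub>v \<Delta> t)) \<and>
    (\<forall>P Q. marginal_BLIP M r Y s P \<longrightarrow> marginal_BLIP M r Y t Q \<longrightarrow> trace_efficient M r Y s t (P, Q))"
proof -
  interpret prob_space M by (rule M)
  have X_meas: "X j \<in> borel_measurable M" if "j \<in> {1..n}" for j
    using indep that by (auto simp: indep_vars_def)
  \<comment> \<open>Since \<sigma>\<delta> = \<mu>, the scale factors out of location and spread
    alike.\<close>
  have Y_eq: "Y i \<omega> = \<sigma> * (Z i \<omega> + \<delta>)" for i \<omega>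
    using sigma_pos by (simp add: Y Z delta std_order_stat_def field_simps)
  have Z_meas: "Z i \<in> borel_measurable M" if "i \<in> {1..n}" for i
    unfolding Z std_order_stat_def[abs_def]
    using borel_measurable_order_stat[OF X_meas that] by measurable
  have Z_int: "integrable M (Z i)" if "i \<in> {1..n}" for i
    using square_integrable_imp_integrable[OF Z_meas second_moments] that by simp
  have ZZ_int: "integrable M (\<lambda>\<omega>. Z i \<omega> * Z j \<omega>)" if "i \<in> {1..n}" "j \<in> {1..n}" for i j
    using that by (intro integrable_mult_of_squares Z_meas second_moments)
  have YY: "(LINT \<omega>|M. Y i \<omega> * Y j \<omega>) =
      \<sigma>\<^sup>2 * (covar M (Z i) (Z j) + (mean M Z i + \<delta>) * (mean M Z j + \<delta>))"
    if "i \<in> {1..n}" "j \<in> {1..n}" for i j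
    unfolding Y_eq mean_def using that by (intro integral_mult_affine Z_int ZZ_int)
  have YY_int: "integrable M (\<lambda>\<omega>. Y i \<omega> * Y j \<omega>)" if "i \<in> {1..n}" "j \<in> {1..n}" for i j
    unfolding Y_eq using Z_int ZZ_int that by (simp add: algebra_simps)
  let ?a = "shifted_mean_vec M r Z \<delta>"
  have a: "?a \<in> carrier_vec r" "\<And>i. i < r \<Longrightarrow> ?a $ i = mean M Z (Suc i) + \<delta>"
    by (auto simp: shifted_mean_vec_def first_vec_def)
  have \<Gamma>: "\<Gamma> \<in> carrier_mat r r" "pos_def_mat \<Gamma>"
    using a(1) pos_def_mat_add_outer_prod[OF Sigma_pos_def _ a(1)] unfolding Gamma Gamma_mat_def
    by (auto simp: cov_mat_def outer_prod_def)
  then obtain B where B: "mat_inverse \<Gamma> = Some B" "\<Gamma> * B = 1\<^sub>m r" "B * \<Gamma> = 1\<^sub>m r"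
    "B \<in> carrier_mat r r"
    using pos_def_mat_inverse by metis
  \<comment> \<open>Proved for any unobserved index \<open>q\<close>, so that \<open>s\<close> and
    \<open>t\<close> are both instances.\<close>
  have BLIP: "marginal_BLIP M r Y q P \<longleftrightarrow> P = lin_pred r Y (the (mat_inverse \<Gamma>) *\<^sub>v \<Delta> q)"
    if q: "r < q" "q \<le> n" for q P
  proof (rule marginal_BLIP_iff[where A = \<Gamma> and k = "\<sigma>\<^sup>2"])
    have \<Delta>: "\<Delta> q \<in> carrier_vec r"
      using a(1) by (auto simp: Delta Delta_vec_def first_vec_def intro!: add_carrier_vec)
    \<comment> \<open>This puts the mixed moments into the form that \<open>d_entry\<close> of
      \<open>marginal_BLIP_iff\<close> asks for.\<close>
    then have "\<Gamma> *\<^sub>v (B *\<^sub>v \<Delta> q) = \<Delta> q"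
      using B \<Gamma> by (simp flip: assoc_mult_mat_vec)
    then show "(LINT \<omega>|M. Y (Suc i) \<omega> * Y q \<omega>) = \<sigma>\<^sup>2 * (\<Gamma> *\<^sub>v (the (mat_inverse \<Gamma>) *\<^sub>v \<Delta> q)) $ i"
      if "i < r" for i
      using that q a B by (simp add: YY Delta Delta_vec_def first_vec_def)
    show "the (mat_inverse \<Gamma>) *\<^sub>v \<Delta> q \<in> carrier_vec r"
      using B \<Delta> by simp
    show "(LINT \<omega>|M. Y (Suc i) \<omega> * Y (Suc j) \<omega>) = \<sigma>\<^sup>2 * \<Gamma> $$ (i, j)" if "i < r" "j < r" for i j
      using that q a by (simp add: YY Gamma Gamma_mat_def cov_mat_def outer_prod_def)
  qed (use q \<Gamma> sigma_pos in \<open>auto intro!: YY_int\<close>)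
  have "invertible_mat \<Gamma>"
    using \<Gamma>(1) B unfolding invertible_mat_def inverts_mat_def by auto
  moreover have "r < t" "s \<le> n"
    using indices by simp_all
  ultimately show ?thesis
    using BLIP indices trace_efficient_of_marginal_BLIPs by blast
qed

end
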